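(* Consider the power network with first-order turbine dynamics described in the context, with parameters proportional to rating: $m_i=f_im$, $d_i=f_id$, $r_i^{-1}=f_ir^{-1}$, $\tau_i=\tau$, where $f_i>0$ and $m,d,r,\tau>0$, subject to the step disturbance $u(t)=u_0\mathbf{1}_{t\ge0}$. Assume the under-damped condition $$\omega_d^2:=\frac{d+r^{-1}}{m\tau}-\frac14\left(\frac1\tau+\frac dm\right)^2>0,$$ and let $\omega_d>0$ and $\eta:=\frac12\left(\frac1\tau+\frac dm\right)$. Then the Nadir, i.e. the $L_\infty$ norm of the system frequency $\bar w$, is $$\|\bar w\|_\infty=\frac{\left|\sum_i u_{0i}\right|}{\sum_i f_i}\,\frac{1}{d+r^{-1}}\left(1+\sqrt{\frac{\tau r^{-1}}{m}}\;e^{-\frac{\eta}{\omega_d}\left(\phi+\frac{\pi}{2}\right)}\right),$$ where $\phi\in(-\frac\pi2,\frac\pi2)$ is uniquely determined by $$\sin(\phi)=\frac{\frac1\tau-\eta}{\sqrt{\omega_d^2+\left(\frac1\tau-\eta\right)^2}}=\frac{m-d\tau}{2\sqrt{m\tau r^{-1}}}.$$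
   Context: There are $n$ generator buses with phase angles $\theta_i$, frequencies $w_i$ and turbine powers $q_i$ (deviations from equilibrium) satisfying $$\dot\theta_i=w_i,\qquad m_i\dot w_i=-d_iw_i+q_i+u_i-p^e_i,\qquad \tau_i\dot q_i=-r_i^{-1}w_i-q_i,$$ with zero initial conditions, where $p^e=L\theta$ and $L\in\mathbb{R}^{n\times n}$ is a symmetric positive semidefinite weighted graph Laplacian of rank $n-1$ with kernel spanned by the all-ones vector. Equivalently, bus $i$ has transfer function from net power $u_i-p_i^e$ to $\theta_i$ given by $g_i(s)=\frac{\tau_is+1}{s(m_i\tau_is^2+(m_i+d_i\tau_i)s+d_i+r_i^{-1})}$, and the proportionality of parameters means $g_i(s)=\frac1{f_i}g_0(s)$ with the representative machine $g_0(s)=\frac{\tau s+1}{s(m\tau s^2+(m+d\tau)s+d+r^{-1})}$. The disturbance is a step in a fixed direction $u_0=(u_{01},\dots,u_{0n})\in\mathbb{R}^n$. The system frequency is $\bar w(t):=\frac{\sum_if_iw_i(t)}{\sum_if_i}$, and $\|\bar w\|_\infty:=\sup_{t\ge0}|\bar w(t)|$. *)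

theory Defs
  imports "HOL-Analysis.Analysis"
begin

definition graph_laplacian :: "('n \<Rightarrow> 'n \<Rightarrow> real) \<Rightarrow> real ^ 'n ^ 'n" where
  "graph_laplacian a = (\<chi> i j. if i = j then (\<Sum>k\<in>UNIV - {i}. a i k) else - a i j)"

(* The sign of the weights is left free; positive semidefiniteness, rank and kernel are
   imposed explicitly.  Nonnegative weights on a connected graph are a special case. *)
definition network_laplacian :: "real ^ 'n ^ 'n \<Rightarrow> bool" where
  "network_laplacian L \<longleftrightarrow>
     (\<exists>a. (\<forall>i j. a i j = a j i) \<and> L = graph_laplacian a) \<and>
     transpose L = L \<and>
     (\<forall>x. 0 \<le> x \<bullet> (L *v x)) \<and>
     rank L = CARD('n) - 1 \<and>
     {x. L *v x = 0} = span {vec 1}"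

(* \<theta>, w, q solve the swing equations with first-order turbines on t \<ge> 0 from zero initial
   conditions; derivatives at t = 0 are one-sided. *)
definition network_response ::
  "real ^ 'n ^ 'n \<Rightarrow> real ^ 'n \<Rightarrow> real ^ 'n \<Rightarrow> real ^ 'n \<Rightarrow> real ^ 'n \<Rightarrow> (real \<Rightarrow> real ^ 'n) \<Rightarrow>
   (real \<Rightarrow> real ^ 'n) \<Rightarrow> (real \<Rightarrow> real ^ 'n) \<Rightarrow> (real \<Rightarrow> real ^ 'n) \<Rightarrow> bool" where
  "network_response L ms ds rs \<tau>s u \<theta> w q \<longleftrightarrow>
     \<theta> 0 = 0 \<and> w 0 = 0 \<and> q 0 = 0 \<and>
     (\<forall>t\<ge>0. \<exists>\<theta>' w' q'.
        (\<theta> has_vector_derivative \<theta>') (at t within {0..}) \<and>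
        (w has_vector_derivative w') (at t within {0..}) \<and>
        (q has_vector_derivative q') (at t within {0..}) \<and>
        (\<forall>i. \<theta>' $ i = w t $ i \<and>
             ms $ i * w' $ i = - ds $ i * w t $ i + q t $ i + u t $ i - (L *v \<theta> t) $ i \<and>
             \<tau>s $ i * q' $ i = - inverse (rs $ i) * w t $ i - q t $ i))"

definition step_disturbance :: "real ^ 'n \<Rightarrow> real \<Rightarrow> real ^ 'n" where
  "step_disturbance u0 t = (if t \<ge> 0 then u0 else 0)"

definition system_frequency :: "real ^ 'n \<Rightarrow> (real \<Rightarrow> real ^ 'n) \<Rightarrow> real \<Rightarrow> real" where
  "system_frequency f w t = (\<Sum>i\<in>UNIV. f $ i * w t $ i) / (\<Sum>i\<in>UNIV. f $ i)"

(* Extended-real valued, so that a finite value entails boundedness. *)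
definition Linf_norm :: "(real \<Rightarrow> real) \<Rightarrow> ereal" where
  "Linf_norm y = (SUP t\<in>{0..}. ereal \<bar>y t\<bar>)"

end

(* Summing the swing equations kills the network coupling, because the Laplacian is symmetric and
   annihilates the all-ones vector.  The system frequency W therefore obeys the planar linear system
   m W' = - d W + Q + U, \<tau> Q' = - W / r - Q, whose solution is unique because the energy
   m W^2 + r \<tau> Q^2 of the difference of two solutions decays.  The explicit solution has W' proportional to
   exp (- \<eta> t) cos (\<omega> t - \<phi>), so W first peaks at t = (\<phi> + pi/2) / \<omega>.  Up to this time W is
   monotone, and afterwards its deviation from the steady state is at most the overshoot, by
   exp (- \<eta> s) (1 + \<eta> s) \<le> 1. *)
theory Submission
  imports Defs
begin

section \<open>From the bus equations to the system frequency\<close>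

text \<open>The entry sum is an inner product with the all-ones vector; symmetry moves
  \<open>L\<close> onto that vector, which it annihilates.\<close>

lemma symmetric_kernel_one_sum_zero:
  fixes L :: "real ^ 'n ^ 'n"
  assumes "transpose L = L" and "L *v vec 1 = 0"
  shows "(\<Sum>i\<in>UNIV. (L *v x) $ i) = 0"
proof -
  have "(\<Sum>i\<in>UNIV. (L *v x) $ i) = vec 1 \<bullet> (L *v x)"
    by (simp add: inner_vec_def)
  also have "\<dots> = (transpose L *v vec 1) \<bullet> x"
    by (metis dot_lmul_matrix transpose_matrix_vector)
  finally show ?thesis
    using assms by simp
qed

lemma has_vector_derivative_vec_nth:
  fixes g :: "real \<Rightarrow> real ^ 'n"
  assumes "(g has_vector_derivative g') F"
  shows "((\<lambda>t. g t $ i) has_vector_derivative g' $ i) F"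
  using bounded_linear.has_vector_derivative[OF bounded_linear_vec_nth assms] .

text \<open>Since inertia, damping and inverse droop all scale with \<open>f $ i\<close>, plain sums
  of the bus equations contain \<open>w\<close> only through its \<open>f\<close>-weighted sum, so
  they close up in the system frequency and \<open>Q\<close>. The common time constant \<tau> does
  the same for the turbines.\<close>

lemma aggregate_swing_equations:
  fixes L :: "real ^ 'n ^ 'n" and f :: "real ^ 'n"
  assumes L: "network_laplacian L" and f: "\<And>i. f $ i > 0"
    and par: "\<And>i. ms $ i = f $ i * m" "\<And>i. ds $ i = f $ i * d"
      "\<And>i. inverse (rs $ i) = f $ i * \<rho>" "\<And>i. \<tau>s $ i = \<tau>"
    and resp: "network_response L ms ds rs \<tau>s (step_disturbance u0) \<theta> w q"
    and mt: "m > 0" "\<tau> > 0" and t: "t \<ge> 0"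
  defines "F \<equiv> \<Sum>i\<in>UNIV. f $ i"
  defines "Q \<equiv> \<lambda>t. (\<Sum>i\<in>UNIV. q t $ i) / F"
  shows "(system_frequency f w has_real_derivative
           (- d * system_frequency f w t + Q t + (\<Sum>i\<in>UNIV. u0 $ i) / F) / m) (at t within {0..})"
    and "(Q has_real_derivative (- \<rho> * system_frequency f w t - Q t) / \<tau>) (at t within {0..})"
proof -
  let ?W = "system_frequency f w"
  have F: "F > 0"
    unfolding F_def by (rule sum_pos) (use f in auto)
  obtain w' q' where w': "(w has_vector_derivative w') (at t within {0..})"
    and q': "(q has_vector_derivative q') (at t within {0..})"
    and ode_w: "\<And>i. ms $ i * w' $ i
        = - ds $ i * w t $ i + q t $ i + step_disturbance u0 t $ i - (L *v \<theta> t) $ i"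
    and ode_q: "\<And>i. \<tau>s $ i * q' $ i = - inverse (rs $ i) * w t $ i - q t $ i"
    using resp t unfolding network_response_def by metis
  have "vec 1 \<in> {x. L *v x = 0}"
    using L unfolding network_laplacian_def by (metis insertI1 span_base)
  then have coupling: "(\<Sum>i\<in>UNIV. (L *v \<theta> t) $ i) = 0"
    using L unfolding network_laplacian_def by (intro symmetric_kernel_one_sum_zero) auto
  have "(\<Sum>i\<in>UNIV. m * (f $ i * w' $ i)) = (\<Sum>i\<in>UNIV.
      - d * (f $ i * w t $ i) + q t $ i + u0 $ i - (L *v \<theta> t) $ i)"
    using ode_w t by (intro sum.cong) (auto simp: par step_disturbance_def algebra_simps)
  then have "m * (\<Sum>i\<in>UNIV. f $ i * w' $ i)
      = - d * (\<Sum>i\<in>UNIV. f $ i * w t $ i) + (\<Sum>i\<in>UNIV. q t $ i) + (\<Sum>i\<in>UNIV. u0 $ i)"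
    using coupling by (simp add: sum.distrib sum_subtractf sum_distrib_left sum_negf)
  then have W_rhs: "(\<Sum>i\<in>UNIV. f $ i * w' $ i) / F
      = (- d * ?W t + Q t + (\<Sum>i\<in>UNIV. u0 $ i) / F) / m"
    using F mt unfolding system_frequency_def Q_def F_def[symmetric] by (simp add: field_simps)
  have "(\<Sum>i\<in>UNIV. \<tau> * q' $ i) = (\<Sum>i\<in>UNIV. - \<rho> * (f $ i * w t $ i) - q t $ i)"
    using ode_q by (intro sum.cong) (auto simp: par algebra_simps)
  then have "\<tau> * (\<Sum>i\<in>UNIV. q' $ i) = - \<rho> * (\<Sum>i\<in>UNIV. f $ i * w t $ i) - (\<Sum>i\<in>UNIV. q t $ i)"
    by (simp add: sum_subtractf sum_distrib_left sum_negf)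
  then have Q_rhs: "(\<Sum>i\<in>UNIV. q' $ i) / F = (- \<rho> * ?W t - Q t) / \<tau>"
    using F mt unfolding system_frequency_def Q_def F_def[symmetric] by (simp add: field_simps)
  have dw: "((\<lambda>t. w t $ i) has_real_derivative w' $ i) (at t within {0..})"
    and dq: "((\<lambda>t. q t $ i) has_real_derivative q' $ i) (at t within {0..})" for i
    using w' q' by (auto simp: has_real_derivative_iff_has_vector_derivative
        intro: has_vector_derivative_vec_nth)
  have "(?W has_real_derivative (\<Sum>i\<in>UNIV. f $ i * w' $ i) / F) (at t within {0..})"
    unfolding system_frequency_def[abs_def] F_def[symmetric]
    by (intro DERIV_cdivide DERIV_sum DERIV_cmult dw)
  then show "(?W has_real_derivative
      (- d * ?W t + Q t + (\<Sum>i\<in>UNIV. u0 $ i) / F) / m) (at t within {0..})"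
    by (simp only: W_rhs)
  have "(Q has_real_derivative (\<Sum>i\<in>UNIV. q' $ i) / F) (at t within {0..})"
    unfolding Q_def by (intro DERIV_cdivide DERIV_sum dq)
  then show "(Q has_real_derivative (- \<rho> * ?W t - Q t) / \<tau>) (at t within {0..})"
    by (simp only: Q_rhs)
qed

section \<open>Uniqueness for the aggregate planar system\<close>

lemma turbine_system_unique:
  fixes m d \<rho> \<tau> U :: real
  assumes pos: "m > 0" "d > 0" "\<rho> > 0" "\<tau> > 0"
    and W: "\<And>t. t \<ge> 0 \<Longrightarrow>
      (W has_real_derivative (- d * W t + Q t + U) / m) (at t within {0..})"
    and Q: "\<And>t. t \<ge> 0 \<Longrightarrow>
      (Q has_real_derivative (- \<rho> * W t - Q t) / \<tau>) (at t within {0..})"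
    and V: "\<And>t. t \<ge> 0 \<Longrightarrow>
      (V has_real_derivative (- d * V t + P t + U) / m) (at t within {0..})"
    and P: "\<And>t. t \<ge> 0 \<Longrightarrow>
      (P has_real_derivative (- \<rho> * V t - P t) / \<tau>) (at t within {0..})"
    and init: "W 0 = V 0" "Q 0 = P 0" and t: "t \<ge> 0"
  shows "W t = V t"
proof -
  \<comment> \<open>With the weight \<open>\<tau> / \<rho>\<close>, the mixed terms of the two
    derivatives are \<open>2 * x * y\<close> and \<open>- 2 * x * y\<close> and cancel, leaving only
    dissipation.\<close>
  define E where "E s = m * (W s - V s)\<^sup>2 + \<tau> / \<rho> * (Q s - P s)\<^sup>2" for s
  define E' where "E' s = - 2 * d * (W s - V s)\<^sup>2 - 2 / \<rho> * (Q s - P s)\<^sup>2" for s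
  have dE: "(E has_real_derivative E' s) (at s within {0..})" if "s \<ge> 0" for s
  proof -
    have dWV: "((\<lambda>s. W s - V s) has_real_derivative (- d * (W s - V s) + (Q s - P s)) / m)
        (at s within {0..})"
      using DERIV_diff[OF W[OF that] V[OF that]]
      by (simp add: diff_divide_distrib[symmetric] algebra_simps)
    have dQP: "((\<lambda>s. Q s - P s) has_real_derivative (- \<rho> * (W s - V s) - (Q s - P s)) / \<tau>)
        (at s within {0..})"
      using DERIV_diff[OF Q[OF that] P[OF that]]
      by (simp add: diff_divide_distrib[symmetric] algebra_simps)
    have "m * (2 * ((- d * x + y) / m * x)) + \<tau> / \<rho> * (2 * ((- \<rho> * x - y) / \<tau> * y))
        = - 2 * d * x\<^sup>2 - 2 / \<rho> * y\<^sup>2" for x y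
      using pos by (simp add: field_simps power2_eq_square)
    from this[of "W s - V s" "Q s - P s"] show ?thesis
      unfolding E_def[abs_def] E'_def
      by (intro DERIV_cong[OF DERIV_add[OF DERIV_cmult[OF DERIV_power[OF dWV, of 2], of m]
          DERIV_cmult[OF DERIV_power[OF dQP, of 2], of "\<tau> / \<rho>"]]]) simp
  qed
  \<comment> \<open>This mean value theorem takes derivatives within the interval, as needed for the
    one-sided derivative at 0.\<close>
  have "\<exists>z\<in>{0..t}. E t - E 0 = E' z * (t - 0)"
  proof (rule mvt_very_simple[OF t])
    fix s assume "0 \<le> s" "s \<le> t"
    have "(E has_real_derivative E' s) (at s within {0..t})"
      by (rule DERIV_subset[OF dE[OF \<open>0 \<le> s\<close>]]) auto
    then show "(E has_derivative (*) (E' s)) (at s within {0..t})"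
      by (simp only: has_field_derivative_def)
  qed
  moreover have "E 0 = 0"
    by (simp add: E_def init)
  moreover have "E' z \<le> 0" for z
  proof -
    have "0 \<le> 2 * d * (W z - V z)\<^sup>2" "0 \<le> 2 / \<rho> * (Q z - P z)\<^sup>2"
      using pos by auto
    then show ?thesis
      unfolding E'_def by linarith
  qed
  ultimately have "E t \<le> 0"
    using t by (auto simp: mult_nonpos_nonneg)
  moreover have "m * (W t - V t)\<^sup>2 \<le> E t"
    using pos by (simp add: E_def)
  ultimately have "m * (W t - V t)\<^sup>2 \<le> 0"
    by linarith
  then show ?thesis
    using pos by (simp add: mult_le_0_iff)
qed

section \<open>The damped oscillation and its first peak\<close>

text \<open>An antiderivative of a multiple of
  \<open>exp (- \<eta> * t) * cos (\<omega> * t - \<phi>)\<close>, scaled so that the sine has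
  coefficient 1; where the cosine vanishes, its absolute value is thus the bare exponential.\<close>

definition damped_wave :: "real \<Rightarrow> real \<Rightarrow> real \<Rightarrow> real \<Rightarrow> real" where
  "damped_wave \<eta> \<omega> \<phi> t = exp (- \<eta> * t) * (sin (\<omega> * t - \<phi>) - \<eta> / \<omega> * cos (\<omega> * t - \<phi>))"

lemma DERIV_damped_wave:
  assumes "\<omega> \<noteq> 0"
  shows "(damped_wave \<eta> \<omega> \<phi> has_real_derivative
           (\<eta>\<^sup>2 + \<omega>\<^sup>2) / \<omega> * exp (- \<eta> * t) * cos (\<omega> * t - \<phi>)) (at t within S)"
  unfolding damped_wave_def[abs_def]
  by (rule derivative_eq_intros refl)+ (use assms in \<open>simp add: field_simps power2_eq_square\<close>)

lemma damped_wave_peak: "damped_wave \<eta> \<omega> \<phi> ((\<phi> + pi / 2) / \<omega>) = exp (- (\<eta> / \<omega>) * (\<phi> + pi / 2))"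
  if "\<omega> \<noteq> 0"
  using that by (simp add: damped_wave_def)

text \<open>Up to the first peak the phase \<open>\<omega> * x - \<phi>\<close> stays in
  \<open>[-pi/2, pi/2]\<close>, where the cosine in the derivative is nonnegative.\<close>

lemma damped_wave_mono:
  assumes "\<omega> > 0" "\<phi> < pi / 2" "0 \<le> s" "s \<le> t" "t \<le> (\<phi> + pi / 2) / \<omega>"
  shows "damped_wave \<eta> \<omega> \<phi> s \<le> damped_wave \<eta> \<omega> \<phi> t"
proof (rule DERIV_nonneg_imp_nondecreasing[OF \<open>s \<le> t\<close>])
  fix x assume x: "s \<le> x" "x \<le> t"
  have "0 \<le> \<omega> * x" "\<omega> * x \<le> \<phi> + pi / 2"
    using x assms by (auto simp: pos_le_divide_eq[symmetric] mult.commute[of \<omega>])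
  then have "0 \<le> cos (\<omega> * x - \<phi>)"
    using assms by (intro cos_ge_zero) auto
  then have "0 \<le> (\<eta>\<^sup>2 + \<omega>\<^sup>2) / \<omega> * exp (- \<eta> * x) * cos (\<omega> * x - \<phi>)"
    using assms by (intro mult_nonneg_nonneg) auto
  then show "\<exists>y. (damped_wave \<eta> \<omega> \<phi> has_real_derivative y) (at x) \<and> 0 \<le> y"
    using DERIV_damped_wave[of \<omega> \<eta> \<phi> x UNIV] assms by auto
qed

text \<open>Measuring time from the peak turns the sine into a cosine. One estimate then covers all
  later times, without an analysis of the later extrema.\<close>

lemma abs_damped_wave_le_peak:
  assumes "\<omega> > 0" "\<eta> > 0" "(\<phi> + pi / 2) / \<omega> \<le> t"
  shows "\<bar>damped_wave \<eta> \<omega> \<phi> t\<bar> \<le> exp (- (\<eta> / \<omega>) * (\<phi> + pi / 2))"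
proof -
  define s where "s = t - (\<phi> + pi / 2) / \<omega>"
  have s: "s \<ge> 0"
    using assms by (simp add: s_def)
  have arg: "\<omega> * t - \<phi> = \<omega> * s + pi / 2"
    using assms by (simp add: s_def field_simps)
  have "\<bar>cos (\<omega> * s) + \<eta> / \<omega> * sin (\<omega> * s)\<bar> \<le> 1 + \<eta> * s"
  proof -
    \<comment> \<open>The bound of the sine by its argument, rather than by 1, cancels the factor
      \<open>1 / \<omega>\<close>, so the result holds for every damping ratio.\<close>
    have "\<bar>\<eta> / \<omega> * sin (\<omega> * s)\<bar> \<le> \<eta> / \<omega> * \<bar>\<omega> * s\<bar>"
      using assms abs_sin_x_le_abs_x[of "\<omega> * s"]
      by (simp only: abs_mult[of "\<eta> / \<omega>"]) (intro mult_mono, auto)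
    also have "\<dots> = \<eta> * s"
      using assms s by simp
    finally show ?thesis
      using abs_cos_le_one[of "\<omega> * s"] by linarith
  qed
  also have "\<dots> \<le> exp (\<eta> * s)"
    by (rule exp_ge_add_one_self)
  finally have "\<bar>damped_wave \<eta> \<omega> \<phi> t\<bar> \<le> exp (- \<eta> * t) * exp (\<eta> * s)"
    unfolding damped_wave_def arg by (simp add: sin_add cos_add abs_mult)
  also have "\<dots> = exp (- (\<eta> / \<omega>) * (\<phi> + pi / 2))"
    using assms by (simp add: s_def exp_add[symmetric] field_simps)
  finally show ?thesis .
qed

lemma Linf_norm_eqI:
  assumes "\<And>t. t \<ge> 0 \<Longrightarrow> \<bar>y t\<bar> \<le> M" and "s \<ge> 0" "\<bar>y s\<bar> = M"
  shows "Linf_norm y = ereal M"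
  unfolding Linf_norm_def
proof (rule antisym)
  show "(SUP t\<in>{0..}. ereal \<bar>y t\<bar>) \<le> ereal M"
    using assms(1) by (intro SUP_least) auto
  show "ereal M \<le> (SUP t\<in>{0..}. ereal \<bar>y t\<bar>)"
    using assms(2,3) by (intro SUP_upper2[of s]) auto
qed

section \<open>Closed-form step response in the under-damped case\<close>

text \<open>Here \<rho> is the inverse droop. The aggregate system has trace
  \<open>- 2 * \<eta>\<close> and determinant \<open>(d + \<rho>) / (m * \<tau>)\<close>, so
  \<open>char_poly\<close> says that its eigenvalues are -\<eta> +- i \<omega>.\<close>

locale underdamped_turbine =
  fixes m d \<rho> \<tau> \<omega> \<eta> :: real
  assumes pos: "m > 0" "d > 0" "\<rho> > 0" "\<tau> > 0" "\<omega> > 0"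
    and \<eta>_eq: "\<eta> = 1 / 2 * (1 / \<tau> + d / m)"
    and char_poly: "\<omega>\<^sup>2 + \<eta>\<^sup>2 = (d + \<rho>) / (m * \<tau>)"
begin

text \<open>The length of the vector (\<omega>, 1/\<tau> - \<eta>), whose polar angle is the phase
  \<phi>.\<close>

definition R :: real where
  "R = sqrt (\<omega>\<^sup>2 + (1 / \<tau> - \<eta>)\<^sup>2)"

lemma \<eta>_pos: "\<eta> > 0"
  using pos by (simp add: \<eta>_eq add_pos_pos)

lemma gain_eq: "d + \<rho> = m * \<tau> * (\<eta>\<^sup>2 + \<omega>\<^sup>2)"
proof -
  have "m * \<tau> * (\<omega>\<^sup>2 + \<eta>\<^sup>2) = d + \<rho>"
    unfolding char_poly using pos by simp
  then show ?thesis
    by (simp add: add.commute)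
qed

lemma natural_frequency_pos: "\<eta>\<^sup>2 + \<omega>\<^sup>2 > 0"
  using pos by (simp add: add_nonneg_pos)

lemma R_pos: "R > 0"
  unfolding R_def using pos by (simp add: add_pos_nonneg)

text \<open>The damping \<open>d\<close> drops out: its share of \<open>char_poly\<close> cancels
  against \<open>1 / \<tau> - 2 * \<eta> = - (d / m)\<close>.\<close>

lemma R_square: "R\<^sup>2 = \<rho> / (m * \<tau>)"
proof -
  have "R\<^sup>2 = \<omega>\<^sup>2 + (1 / \<tau> - \<eta>)\<^sup>2"
    by (simp add: R_def)
  also have "\<dots> = (\<omega>\<^sup>2 + \<eta>\<^sup>2) + 1 / \<tau> * (1 / \<tau> - 2 * \<eta>)"
    by (simp add: power2_eq_square algebra_simps)
  also have "1 / \<tau> - 2 * \<eta> = - (d / m)"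
    by (simp add: \<eta>_eq add_divide_distrib)
  also have "\<omega>\<^sup>2 + \<eta>\<^sup>2 + 1 / \<tau> * - (d / m) = \<rho> / (m * \<tau>)"
    unfolding char_poly using pos by (simp add: add_divide_distrib)
  finally show ?thesis .
qed

lemma \<tau>_R_eq: "\<tau> * R = sqrt (\<tau> * \<rho> / m)"
proof -
  have "(\<tau> * R)\<^sup>2 = \<tau> * \<rho> / m"
    unfolding power_mult_distrib R_square using pos by (simp add: power2_eq_square)
  then show ?thesis
    using pos R_pos by (metis real_sqrt_unique mult_pos_pos less_imp_le)
qed

lemma sin_phase_eq: "(1 / \<tau> - \<eta>) / R = (m - d * \<tau>) / (2 * sqrt (m * \<tau> * \<rho>))"
proof -
  have "(m * \<tau> * R)\<^sup>2 = m * \<tau> * \<rho>"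
    unfolding power_mult_distrib R_square using pos by (simp add: power2_eq_square)
  then have "sqrt (m * \<tau> * \<rho>) = m * \<tau> * R"
    using pos R_pos by (metis real_sqrt_unique mult_pos_pos less_imp_le)
  moreover have "1 / \<tau> - \<eta> = (m - d * \<tau>) / (2 * (m * \<tau>))"
    using pos by (simp add: \<eta>_eq field_simps)
  ultimately show ?thesis
    by simp
qed

lemma unique_phase: "\<exists>!\<phi>. \<phi> \<in> {- (pi / 2) <..< pi / 2} \<and> sin \<phi> = (1 / \<tau> - \<eta>) / R"
proof -
  \<comment> \<open>Strict because \<omega> > 0; hence the arcsine avoids the endpoints of its
    range.\<close>
  have "\<bar>1 / \<tau> - \<eta>\<bar> < R"
    unfolding R_def using pos by (intro real_less_rsqrt) simp
  then have bounds: "- 1 < (1 / \<tau> - \<eta>) / R" "(1 / \<tau> - \<eta>) / R < 1"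
    using R_pos by (auto simp: pos_less_divide_eq pos_divide_less_eq)
  show ?thesis
  proof (rule ex1I[of _ "arcsin ((1 / \<tau> - \<eta>) / R)"])
    show "arcsin ((1 / \<tau> - \<eta>) / R) \<in> {- (pi / 2) <..< pi / 2} \<and>
        sin (arcsin ((1 / \<tau> - \<eta>) / R)) = (1 / \<tau> - \<eta>) / R"
      using bounds arcsin_lt_bounded[OF bounds] by (simp add: sin_arcsin)
  next
    fix \<phi> assume *: "\<phi> \<in> {- (pi / 2) <..< pi / 2} \<and> sin \<phi> = (1 / \<tau> - \<eta>) / R"
    then have "arcsin (sin \<phi>) = \<phi>"
      by (intro arcsin_sin) auto
    with * show "\<phi> = arcsin ((1 / \<tau> - \<eta>) / R)"
      by simp
  qed
qed

text \<open>The sine fixes the cosine up to sign, and the open interval makes it positive.\<close>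

lemma cos_phase:
  assumes "\<phi> \<in> {- (pi / 2) <..< pi / 2}" "sin \<phi> = (1 / \<tau> - \<eta>) / R"
  shows "cos \<phi> = \<omega> / R"
proof -
  have "(cos \<phi>)\<^sup>2 = 1 - ((1 / \<tau> - \<eta>) / R)\<^sup>2"
    unfolding assms(2)[symmetric] by (simp add: cos_squared_eq)
  also have "\<dots> = (R\<^sup>2 - (1 / \<tau> - \<eta>)\<^sup>2) / R\<^sup>2"
    unfolding power_divide using R_pos by (subst diff_divide_distrib) simp
  also have "\<dots> = (\<omega> / R)\<^sup>2"
    by (simp add: R_def power_divide)
  finally have "(cos \<phi>)\<^sup>2 = (\<omega> / R)\<^sup>2" .
  moreover have "cos \<phi> > 0"
    using assms(1) by (intro cos_gt_zero_pi) auto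
  ultimately show ?thesis
    using pos R_pos by (simp add: power2_eq_iff_nonneg)
qed

definition step_response :: "real \<Rightarrow> real \<Rightarrow> real \<Rightarrow> real" where
  "step_response U \<phi> t = U / (d + \<rho>) * (1 + \<tau> * R * damped_wave \<eta> \<omega> \<phi> t)"

definition step_response_deriv :: "real \<Rightarrow> real \<Rightarrow> real \<Rightarrow> real" where
  "step_response_deriv U \<phi> t = U * R / (m * \<omega>) * (exp (- \<eta> * t) * cos (\<omega> * t - \<phi>))"

text \<open>The swing equation solved for the turbine power. That equation then holds by
  construction, and only the turbine equation is left to check.\<close>

definition turbine_response :: "real \<Rightarrow> real \<Rightarrow> real \<Rightarrow> real" where
  "turbine_response U \<phi> t = m * step_response_deriv U \<phi> t + d * step_response U \<phi> t - U"

text \<open>Exactly the value that cancels the constant 1 in \<open>step_response\<close>, so that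
  the frequency starts at zero.\<close>

lemma damped_wave_0:
  assumes "\<phi> \<in> {- (pi / 2) <..< pi / 2}" "sin \<phi> = (1 / \<tau> - \<eta>) / R"
  shows "damped_wave \<eta> \<omega> \<phi> 0 = - 1 / (\<tau> * R)"
proof -
  have "damped_wave \<eta> \<omega> \<phi> 0 = - ((1 / \<tau> - \<eta>) / R + \<eta> / \<omega> * (\<omega> / R))"
    by (simp add: damped_wave_def assms(2) cos_phase[OF assms])
  also have "\<dots> = - 1 / (\<tau> * R)"
    using pos R_pos by (simp add: diff_divide_distrib)
  finally show ?thesis .
qed

lemma step_response_0:
  assumes "\<phi> \<in> {- (pi / 2) <..< pi / 2}" "sin \<phi> = (1 / \<tau> - \<eta>) / R"
  shows "step_response U \<phi> 0 = 0"
  unfolding step_response_def damped_wave_0[OF assms] using pos R_pos by simp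

text \<open>The initial acceleration is \<open>U / m\<close>, by the value of
  \<open>cos \<phi>\<close>, so the inertial term absorbs the whole disturbance.\<close>

lemma turbine_response_0:
  assumes "\<phi> \<in> {- (pi / 2) <..< pi / 2}" "sin \<phi> = (1 / \<tau> - \<eta>) / R"
  shows "turbine_response U \<phi> 0 = 0"
  unfolding turbine_response_def step_response_0[OF assms] step_response_deriv_def
  using pos R_pos cos_phase[OF assms] by simp

lemma DERIV_step_response:
  "(step_response U \<phi> has_real_derivative step_response_deriv U \<phi> t) (at t within S)"
proof -
  let ?N = "\<eta>\<^sup>2 + \<omega>\<^sup>2" and ?e = "exp (- \<eta> * t) * cos (\<omega> * t - \<phi>)"
  have "(step_response U \<phi> has_real_derivative
      U / (d + \<rho>) * (0 + \<tau> * R * (?N / \<omega> * exp (- \<eta> * t) * cos (\<omega> * t - \<phi>)))) (at t within S)"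
    unfolding step_response_def[abs_def] using pos
    by (intro DERIV_cmult DERIV_add DERIV_const DERIV_damped_wave) simp
  \<comment> \<open>By \<open>gain_eq\<close> the steady-state gain carries \<open>?N\<close> in its
    denominator, which cancels the same factor from the wave.\<close>
  moreover have "U / (m * \<tau> * ?N) * (0 + \<tau> * R * (?N / \<omega> * exp (- \<eta> * t) * cos (\<omega> * t - \<phi>)))
      = U * R / (m * \<omega>) * ?e"
    using pos natural_frequency_pos by simp
  ultimately show ?thesis
    by (simp only: step_response_deriv_def gain_eq)
qed

text \<open>The second-order scalar equation obtained by eliminating the turbine power, here
  verified on the closed form.\<close>

lemma DERIV_step_response_deriv:
  "(step_response_deriv U \<phi> has_real_derivative
     - 2 * \<eta> * step_response_deriv U \<phi> t - ((d + \<rho>) * step_response U \<phi> t - U) / (m * \<tau>))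
     (at t within S)"
proof -
  define c where "c = U * R / (m * \<omega>)"
  define e where "e = exp (- \<eta> * t)"
  define C where "C = cos (\<omega> * t - \<phi>)"
  define S' where "S' = sin (\<omega> * t - \<phi>)"
  have "(step_response_deriv U \<phi> has_real_derivative c * (- \<eta> * e * C - \<omega> * e * S')) (at t within S)"
    unfolding step_response_deriv_def[abs_def] c_def e_def C_def S'_def
    by (rule derivative_eq_intros refl)+ (simp add: algebra_simps)
  moreover have "((d + \<rho>) * step_response U \<phi> t - U) / (m * \<tau>) = c * (\<omega> * e * S' - \<eta> * e * C)"
  proof -
    have "(d + \<rho>) * step_response U \<phi> t = U * (1 + \<tau> * R * damped_wave \<eta> \<omega> \<phi> t)"
      using pos by (simp add: step_response_def)
    then have "((d + \<rho>) * step_response U \<phi> t - U) / (m * \<tau>)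
        = U * R / m * damped_wave \<eta> \<omega> \<phi> t"
      using pos by (simp add: distrib_left)
    also have "\<dots> = c * \<omega> * (e * (S' - \<eta> / \<omega> * C))"
      using pos by (simp add: damped_wave_def c_def e_def C_def S'_def)
    also have "\<dots> = c * (\<omega> * e * S' - \<eta> * e * C)"
      using pos by (simp add: algebra_simps)
    finally show ?thesis .
  qed
  moreover have "step_response_deriv U \<phi> t = c * (e * C)"
    by (simp add: step_response_deriv_def c_def e_def C_def)
  ultimately show ?thesis
    by (auto elim!: DERIV_cong simp: right_diff_distrib)
qed

lemma DERIV_turbine_response:
  "(turbine_response U \<phi> has_real_derivative
     (- \<rho> * step_response U \<phi> t - turbine_response U \<phi> t) / \<tau>) (at t within S)"
proof -
  define V where "V = step_response U \<phi> t"
  define V' where "V' = step_response_deriv U \<phi> t"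
  have "(turbine_response U \<phi> has_real_derivative
      m * (- 2 * \<eta> * V' - ((d + \<rho>) * V - U) / (m * \<tau>)) + d * V' - 0) (at t within S)"
    unfolding turbine_response_def[abs_def] V_def V'_def
    by (intro DERIV_diff DERIV_add DERIV_cmult DERIV_const DERIV_step_response
        DERIV_step_response_deriv)
  \<comment> \<open>As \<open>2 * \<eta> = 1 / \<tau> + d / m\<close>, the terms in
    \<open>d * V'\<close> cancel and \<open>- m * V' / \<tau>\<close> remains.\<close>
  moreover have "m * (- 2 * \<eta> * V' - ((d + \<rho>) * V - U) / (m * \<tau>)) + d * V' - 0
      = (- \<rho> * V - (m * V' + d * V - U)) / \<tau>"
    using pos by (simp add: \<eta>_eq field_simps)
  ultimately show ?thesis
    by (simp only: turbine_response_def V_def V'_def)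
qed

text \<open>Before the peak, monotonicity keeps the expression between its initial value 0 and its
  peak value; afterwards the triangle inequality suffices.\<close>

lemma overshoot_bound:
  assumes \<phi>: "\<phi> \<in> {- (pi / 2) <..< pi / 2}" "sin \<phi> = (1 / \<tau> - \<eta>) / R" and t: "t \<ge> 0"
  shows "\<bar>1 + \<tau> * R * damped_wave \<eta> \<omega> \<phi> t\<bar>
    \<le> 1 + \<tau> * R * exp (- (\<eta> / \<omega>) * (\<phi> + pi / 2))"
proof -
  let ?T = "(\<phi> + pi / 2) / \<omega>" and ?h = "damped_wave \<eta> \<omega> \<phi>"
  have \<tau>R: "\<tau> * R > 0"
    using pos R_pos by simp
  show ?thesis
  proof (cases "t \<le> ?T")
    case True
    have "- 1 / (\<tau> * R) \<le> ?h t"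
      unfolding damped_wave_0[OF \<phi>, symmetric] using True t pos \<phi> by (intro damped_wave_mono) auto
    then have "0 \<le> 1 + \<tau> * R * ?h t"
      unfolding pos_divide_le_eq[OF \<tau>R] by (simp add: mult.commute)
    moreover have "?h t \<le> ?h ?T"
      using True t pos \<phi> by (intro damped_wave_mono) auto
    then have "\<tau> * R * ?h t \<le> \<tau> * R * exp (- (\<eta> / \<omega>) * (\<phi> + pi / 2))"
      using \<tau>R pos by (intro mult_left_mono) (auto simp: damped_wave_peak)
    ultimately show ?thesis
      by linarith
  next
    case False
    then have "\<bar>?h t\<bar> \<le> exp (- (\<eta> / \<omega>) * (\<phi> + pi / 2))"
      using pos \<eta>_pos by (intro abs_damped_wave_le_peak) auto
    then have "\<tau> * R * \<bar>?h t\<bar> \<le> \<tau> * R * exp (- (\<eta> / \<omega>) * (\<phi> + pi / 2))"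
      using \<tau>R by (intro mult_left_mono) auto
    moreover have "\<bar>\<tau> * R * ?h t\<bar> = \<tau> * R * \<bar>?h t\<bar>"
      using \<tau>R by (simp only: abs_mult[of "\<tau> * R"] abs_of_pos)
    ultimately show ?thesis
      by linarith
  qed
qed

text \<open>The overshoot bound is attained at the peak time, which is nonnegative because \<phi> >
  -pi/2.\<close>

lemma Linf_norm_step_response:
  assumes \<phi>: "\<phi> \<in> {- (pi / 2) <..< pi / 2}" "sin \<phi> = (1 / \<tau> - \<eta>) / R"
    and W: "\<And>t. t \<ge> 0 \<Longrightarrow> W t = step_response U \<phi> t"
  shows "Linf_norm W = ereal (\<bar>U\<bar> * (1 / (d + \<rho>)) *
    (1 + sqrt (\<tau> * \<rho> / m) * exp (- (\<eta> / \<omega>) * (\<phi> + pi / 2))))"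
  unfolding \<tau>_R_eq[symmetric]
proof (rule Linf_norm_eqI)
  have abs_eq: "\<bar>step_response U \<phi> t\<bar>
      = \<bar>U\<bar> * (1 / (d + \<rho>)) * \<bar>1 + \<tau> * R * damped_wave \<eta> \<omega> \<phi> t\<bar>" for t
    using pos by (simp add: step_response_def abs_mult)
  fix t :: real assume t: "t \<ge> 0"
  show "\<bar>W t\<bar> \<le> \<bar>U\<bar> * (1 / (d + \<rho>)) * (1 + \<tau> * R * exp (- (\<eta> / \<omega>) * (\<phi> + pi / 2)))"
    unfolding W[OF t] abs_eq using overshoot_bound[OF \<phi> t] pos by (intro mult_left_mono) auto
next
  show T: "(\<phi> + pi / 2) / \<omega> \<ge> 0"
    using \<phi> pos by simp
  have "1 + \<tau> * R * exp (- (\<eta> / \<omega>) * (\<phi> + pi / 2)) > 0"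
    using pos R_pos by (intro add_pos_pos mult_pos_pos) auto
  moreover have "damped_wave \<eta> \<omega> \<phi> ((\<phi> + pi / 2) / \<omega>) = exp (- (\<eta> / \<omega>) * (\<phi> + pi / 2))"
    using pos by (intro damped_wave_peak) simp
  ultimately show "\<bar>W ((\<phi> + pi / 2) / \<omega>)\<bar>
      = \<bar>U\<bar> * (1 / (d + \<rho>)) * (1 + \<tau> * R * exp (- (\<eta> / \<omega>) * (\<phi> + pi / 2)))"
    unfolding W[OF T] step_response_def abs_mult using pos by simp
qed

end

section \<open>The Nadir of the network\<close>

theorem proposition3:
  fixes L :: "real ^ 'n ^ 'n"
    and f ms ds rs \<tau>s u0 :: "real ^ 'n"
    and \<theta> w q :: "real \<Rightarrow> real ^ 'n"
    and m d r \<tau> \<omega>\<^sub>d \<eta> :: real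
  assumes "network_laplacian L"
    and "\<And>i. f $ i > 0" and "m > 0" and "d > 0" and "r > 0" and "\<tau> > 0"
    and "\<And>i. ms $ i = f $ i * m"
    and "\<And>i. ds $ i = f $ i * d"
    and "\<And>i. inverse (rs $ i) = f $ i * inverse r"
    and "\<And>i. \<tau>s $ i = \<tau>"
    and "network_response L ms ds rs \<tau>s (step_disturbance u0) \<theta> w q"
    and "\<omega>\<^sub>d\<^sup>2 = (d + inverse r) / (m * \<tau>) - 1 / 4 * (1 / \<tau> + d / m)\<^sup>2"
    and "(d + inverse r) / (m * \<tau>) - 1 / 4 * (1 / \<tau> + d / m)\<^sup>2 > 0"
    and "\<omega>\<^sub>d > 0"
    and "\<eta> = 1 / 2 * (1 / \<tau> + d / m)"
  shows "(1 / \<tau> - \<eta>) / sqrt (\<omega>\<^sub>d\<^sup>2 + (1 / \<tau> - \<eta>)\<^sup>2)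
           = (m - d * \<tau>) / (2 * sqrt (m * \<tau> * inverse r)) \<and>
         (\<exists>!\<phi>. \<phi> \<in> {- (pi / 2) <..< pi / 2} \<and>
            sin \<phi> = (1 / \<tau> - \<eta>) / sqrt (\<omega>\<^sub>d\<^sup>2 + (1 / \<tau> - \<eta>)\<^sup>2)) \<and>
         (\<forall>\<phi>. \<phi> \<in> {- (pi / 2) <..< pi / 2} \<and>
            sin \<phi> = (1 / \<tau> - \<eta>) / sqrt (\<omega>\<^sub>d\<^sup>2 + (1 / \<tau> - \<eta>)\<^sup>2) \<longrightarrow>
            Linf_norm (system_frequency f w) =
              ereal (\<bar>\<Sum>i\<in>UNIV. u0 $ i\<bar> / (\<Sum>i\<in>UNIV. f $ i) * (1 / (d + inverse r)) *
                (1 + sqrt (\<tau> * inverse r / m) * exp (- (\<eta> / \<omega>\<^sub>d) * (\<phi> + pi / 2)))))"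
proof -
  define F where "F = (\<Sum>i\<in>UNIV. f $ i)"
  define U where "U = (\<Sum>i\<in>UNIV. u0 $ i) / F"
  define Q where "Q = (\<lambda>t. (\<Sum>i\<in>UNIV. q t $ i) / F)"
  interpret underdamped_turbine m d "inverse r" \<tau> \<omega>\<^sub>d \<eta>
  proof
    \<comment> \<open>The subtracted quarter-square in the formula for
      \<open>\<omega>\<^sub>d\<^sup>2\<close> is \<open>\<eta>\<^sup>2\<close>.\<close>
    show "\<omega>\<^sub>d\<^sup>2 + \<eta>\<^sup>2 = (d + inverse r) / (m * \<tau>)"
      unfolding assms(12,15) by (simp add: power_divide)
  qed (use assms in auto)
  have "Linf_norm (system_frequency f w) =
      ereal (\<bar>\<Sum>i\<in>UNIV. u0 $ i\<bar> / F * (1 / (d + inverse r)) *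
        (1 + sqrt (\<tau> * inverse r / m) * exp (- (\<eta> / \<omega>\<^sub>d) * (\<phi> + pi / 2))))"
    if \<phi>: "\<phi> \<in> {- (pi / 2) <..< pi / 2}" "sin \<phi> = (1 / \<tau> - \<eta>) / R" for \<phi>
  proof -
    have F: "F > 0"
      unfolding F_def by (rule sum_pos) (use assms(2) in auto)
    \<comment> \<open>Both sides, paired with \<open>Q\<close> and
      \<open>turbine_response U \<phi>\<close>, solve the planar system from zero initial
      values.\<close>
    have "system_frequency f w t = step_response U \<phi> t" if t: "t \<ge> 0" for t
    proof (rule turbine_system_unique[OF pos(1-4), where U = U and W = "system_frequency f w" and Q = Q
          and V = "step_response U \<phi>" and P = "turbine_response U \<phi>"])
      fix t :: real assume t: "t \<ge> 0"
      note aggregate = aggregate_swing_equations[OF assms(1,2,7-11,3,6) t]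
      show "(system_frequency f w has_real_derivative
          (- d * system_frequency f w t + Q t + U) / m) (at t within {0..})"
        using aggregate(1) by (simp only: Q_def U_def F_def)
      show "(Q has_real_derivative
          (- inverse r * system_frequency f w t - Q t) / \<tau>) (at t within {0..})"
        using aggregate(2) by (simp only: Q_def F_def)
      show "(step_response U \<phi> has_real_derivative
          (- d * step_response U \<phi> t + turbine_response U \<phi> t + U) / m) (at t within {0..})"
        using DERIV_step_response[of U \<phi> t] pos by (simp add: turbine_response_def)
      show "(turbine_response U \<phi> has_real_derivative
          (- inverse r * step_response U \<phi> t - turbine_response U \<phi> t) / \<tau>) (at t within {0..})"
        by (rule DERIV_turbine_response)
    next
      have "w 0 = 0" "q 0 = 0"
        using assms(11) by (simp_all add: network_response_def)
      then show "system_frequency f w 0 = step_response U \<phi> 0" "Q 0 = turbine_response U \<phi> 0"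
        by (simp_all add: system_frequency_def Q_def step_response_0[OF \<phi>] turbine_response_0[OF \<phi>])
    qed (rule t)
    from Linf_norm_step_response[OF \<phi> this] show ?thesis
      using F by (simp add: U_def)
  qed
  then show ?thesis
    using sin_phase_eq unique_phase unfolding R_def F_def by blast
qed

end
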